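(* Let $G$ be a multigraph, and let $F$ be a field of characteristic $0$ or $F=\mathbb{Z}_p$ with $p$ prime. Let $(L,C)$ be an $F$-correspondence assignment on $G$ that is $Z$-signable with respect to some orientation $D$ of $G$, with generalized sign function $\varphi_C:E(G)\to\langle 1\rangle\setminus\{0\}$ written as $\varphi_C=\sigma_C\varphi_C^+$, and let $D_{\sigma,\varphi}$ be the associated auxiliary digraph. Suppose that $EE(D_{\sigma,\varphi})-EO(D_{\sigma,\varphi})\not\equiv 0_F$ and that $|L(v)|\ge d^+_D(v)+1$ for each $v\in V(G)$. Then $G$ is $(L,C)$-colorable.
   Context: Graphs. Multigraphs and digraphs are finite and loopless; parallel edges are allowed and are regarded as distinct. Write $e=\{v,w\}$ if $v,w$ are the endpoints of the edge $e$, and $\vec e=(v,w)$ if $\vec e$ is a directed edge from $v$ to $w$. An orientation $D$ of a multigraph $G$ is a digraph on vertex set $V(G)$ obtained by choosing one direction for each edge; $\vec e$ is the directed edge of $D$ corresponding to $e\in E(G)$. $d^+_D(v)$ and $d^-_D(v)$ are the out-degree and in-degree of $v$ in $D$. Eulerian subdigraphs. A digraph $H$ is Eulerian if $d^+_H(v)=d^-_H(v)$ for every vertex $v$ (connectedness is not required). A digraph is even (odd) if it has an even (odd) number of edges. $EE(H)$ and $EO(H)$ denote the numbers of even, respectively odd, spanning Eulerian subdigraphs of $H$ (spanning means having vertex set $V(H)$; the subdigraph with no edges counts). Correspondence assignments. A correspondence assignment $(L,C)$ for $G$ consists of lists $L=\{L(v)\}_{v\in V(G)}$ and a function $C$ assigning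 to every edge $e=\{u,v\}$ a partial matching $C_e$ between $\{u\}\times L(u)$ and $\{v\}\times L(v)$. An $(L,C)$-coloring is a function $f$ with $f(v)\in L(v)$ for all $v\in V(G)$ such that for every edge $e=\{u,v\}$ the pair $\{(u,f(u)),(v,f(v))\}$ is not in $C_e$; $G$ is $(L,C)$-colorable if one exists. For a field $F$, $(L,C)$ is an $F$-correspondence assignment if $L(v)\subseteq F$ for all $v$. $Z$-signable. Let $\langle 1\rangle$ be the additive subgroup of $F$ generated by $1$ (identified with $\mathbb{Z}$ when $F$ has characteristic $0$; equal to $\mathbb{Z}_p$ when $F=\mathbb{Z}_p$). $(L,C)$ is $Z$-signable with respect to an orientation $D$ of $G$ if there is a function $\varphi_C:E(G)\to\langle 1\rangle\setminus\{0\}$ (the generalized sign function of $(L,C)$ with respect to $D$) such that for each $\vec e=(v,w)\in\vec E(D)$ there is $a_{\vec e}\in F$ with $c_1-\varphi_C(e)c_2=a_{\vec e}$ whenever $\{(v,c_1),(w,c_2)\}\in C_e$. One writes $\varphi_C(e)=\sigma_C(e)\varphi_C^+(e)$ with $\sigma_C(e)\in\{1,-1\}$ and $\varphi_C^+(e)$ a positive integer, as follows. If $F$ has characteristic $0$, $\sigma_C(e)$ is the sign of the integer $\varphi_C(e)$ and $\varphi_C^+(e)=|\varphi_C(e)|$. If $F=\mathbb{Z}_p$, $\sigma_C:E(G)\to\{1,-1\}$ may be any function and $\varphi_C^+(e)\in\{1,\dots,p-1\}$ is the integer for which $\varphi_C(e)=\sigma_C(e)\varphi_C^+(e)$ in $\mathbb{Z}_p$.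 Auxiliary digraph. $D_{\sigma,\varphi}$ is obtained from $D$ by replacing each $\vec e=(v,w)\in\vec E(D)$ as follows: delete $\vec e$, add two new vertices $v_{\vec e},w_{\vec e}$ and the edges $(v,v_{\vec e})$, $(w_{\vec e},w)$; if $\sigma_C(e)=1$, add $\varphi_C^+(e)$ parallel edges $\vec e_1,\dots,\vec e_{\varphi_C^+(e)}$ from $v_{\vec e}$ to $w_{\vec e}$; if $\sigma_C(e)=-1$, add new vertices $x^1_{\vec e},\dots,x^{\varphi_C^+(e)}_{\vec e}$ and the edges $(v_{\vec e},x^i_{\vec e})$, $(x^i_{\vec e},w_{\vec e})$ for $1\le i\le\varphi_C^+(e)$. (New vertices for different edges of $D$ are distinct.) For $n\in\mathbb{Z}$, $n\equiv 0_F$ means $n=0$ if $F$ has characteristic $0$, and $n\equiv 0\pmod p$ if $F=\mathbb{Z}_p$. *)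

theory Defs
  imports
    "Graph_Theory.Digraph"
    "Graph_Theory.Digraph_Component"
    "HOL-Library.Disjoint_Sets"
    "HOL-Number_Theory.Residues"
    "HOL-Algebra.Algebraic_Closure_Type"
begin

section \<open>Multigraphs and orientations\<close>

text \<open>Edges are named by elements of \<open>'e\<close>, so parallel edges are distinct.\<close>

record ('v, 'e) multigraph =
  mverts :: "'v set"
  medges :: "'e set"
  mends :: "'e \<Rightarrow> 'v set"

definition finite_loopless_multigraph :: "('v, 'e) multigraph \<Rightarrow> bool" where
  "finite_loopless_multigraph G \<longleftrightarrow>
     finite (mverts G) \<and> finite (medges G) \<and>
     (\<forall>e \<in> medges G. \<exists>u \<in> mverts G. \<exists>v \<in> mverts G. u \<noteq> v \<and> mends G e = {u, v})"

definition is_orientation :: "('v, 'e) pre_digraph \<Rightarrow> ('v, 'e) multigraph \<Rightarrow> bool" where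
  "is_orientation D G \<longleftrightarrow>
     verts D = mverts G \<and> arcs D = medges G \<and>
     (\<forall>e \<in> medges G. mends G e = {tail D e, head D e})"

lemma orientation_loopfree_fin_digraph:
  assumes "finite_loopless_multigraph G" "is_orientation D G"
  shows "fin_digraph D" "loopfree_digraph D"
proof -
  have *: "tail D e \<in> verts D \<and> head D e \<in> verts D \<and> tail D e \<noteq> head D e"
    if "e \<in> arcs D" for e
    using assms that unfolding finite_loopless_multigraph_def is_orientation_def
    by (metis doubleton_eq_iff)
  show "fin_digraph D"
    using assms * by unfold_locales (auto simp: finite_loopless_multigraph_def is_orientation_def)
  show "loopfree_digraph D"
    using * by unfold_locales auto
qed


section \<open>Eulerian subdigraphs\<close>

definition eulerian_digraph :: "('a, 'b) pre_digraph \<Rightarrow> bool" where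
  "eulerian_digraph H \<longleftrightarrow> (\<forall>v \<in> verts H. out_degree H v = in_degree H v)"

text \<open>A \<^const>\<open>subgraph\<close> carries the same total functions \<^const>\<open>tail\<close> and \<^const>\<open>head\<close> as
  the ambient digraph, so each spanning subdigraph is counted exactly once.\<close>

definition EE :: "('a, 'b) pre_digraph \<Rightarrow> nat" where
  "EE D = card {H. spanning H D \<and> eulerian_digraph H \<and> even (card (arcs H))}"

definition EO :: "('a, 'b) pre_digraph \<Rightarrow> nat" where
  "EO D = card {H. spanning H D \<and> eulerian_digraph H \<and> odd (card (arcs H))}"


section \<open>Correspondence assignments\<close>

definition partial_matching_between :: "'a set \<Rightarrow> 'a set \<Rightarrow> 'a set set \<Rightarrow> bool" where
  "partial_matching_between A B M \<longleftrightarrow> M \<subseteq> {{a, b} |a b. a \<in> A \<and> b \<in> B} \<and> disjoint M"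

definition correspondence_assignment ::
  "('v, 'e) multigraph \<Rightarrow> ('v \<Rightarrow> 'c set) \<Rightarrow> ('e \<Rightarrow> ('v \<times> 'c) set set) \<Rightarrow> bool" where
  "correspondence_assignment G L C \<longleftrightarrow>
     (\<forall>e \<in> medges G. \<forall>u v. mends G e = {u, v} \<longrightarrow>
        partial_matching_between ({u} \<times> L u) ({v} \<times> L v) (C e))"

definition LC_coloring ::
  "('v, 'e) multigraph \<Rightarrow> ('v \<Rightarrow> 'c set) \<Rightarrow> ('e \<Rightarrow> ('v \<times> 'c) set set) \<Rightarrow> ('v \<Rightarrow> 'c) \<Rightarrow> bool" where
  "LC_coloring G L C f \<longleftrightarrow>
     (\<forall>v \<in> mverts G. f v \<in> L v) \<and>
     (\<forall>e \<in> medges G. \<forall>u v. mends G e = {u, v} \<longrightarrow> {(u, f u), (v, f v)} \<notin> C e)"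

definition LC_colorable ::
  "('v, 'e) multigraph \<Rightarrow> ('v \<Rightarrow> 'c set) \<Rightarrow> ('e \<Rightarrow> ('v \<times> 'c) set set) \<Rightarrow> bool" where
  "LC_colorable G L C \<longleftrightarrow> (\<exists>f. LC_coloring G L C f)"


section \<open>The field\<close>

text \<open>The field is the type \<open>'f\<close>; "equal to \<open>Z\<^sub>p\<close>" means isomorphic, as a ring, to the integers
  modulo the prime \<open>p\<close>. In this case \<open>CHAR('f)\<close> is \<open>p\<close>, which is why the definitions below
  can refer to the characteristic alone.\<close>

definition is_Zp :: "'f :: field itself \<Rightarrow> nat \<Rightarrow> bool" where
  "is_Zp TYPE('f) p \<longleftrightarrow>
     Factorial_Ring.prime p \<and> (ring_of_type_algebra :: 'f ring) \<simeq> residue_ring (int p)"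

lemma is_Zp_CHAR:
  assumes "is_Zp TYPE('f :: field) p"
  shows "CHAR('f) = p"
proof -
  from assms obtain h where h: "h \<in> ring_iso (ring_of_type_algebra :: 'f ring) (residue_ring (int p))"
    and p: "Factorial_Ring.prime p"
    unfolding is_Zp_def is_ring_iso_def by auto
  have p1: "int p > 1"
    using p prime_gt_1_nat by auto
  have inj: "inj h"
    using h unfolding ring_iso_def bij_betw_def ring_of_type_algebra_def by simp
  have add: "h (x + y) = (h x + h y) mod int p" for x y
    using h unfolding ring_iso_def ring_hom_def ring_of_type_algebra_def residue_ring_def by auto
  have one: "h 1 = 1"
    using h unfolding ring_iso_def ring_hom_def ring_of_type_algebra_def residue_ring_def by auto
  have carr: "h x \<in> {0..int p - 1}" for x
    using h unfolding ring_iso_def ring_hom_def ring_of_type_algebra_def residue_ring_def by auto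
  have zero: "h 0 = 0"
  proof -
    have "[h 0 + 0 = h 0 + h 0] (mod int p)"
      using arg_cong[OF add[of 0 0], of "\<lambda>z. z mod int p"]
      by (simp only: cong_def add_0_right mod_mod_trivial)
    then have "[0 = h 0] (mod int p)"
      by (simp only: cong_add_lcancel)
    then show ?thesis
      using carr[of 0] by (simp add: cong_def)
  qed
  have of_nat: "h (of_nat n) = int n mod int p" for n
  proof (induction n)
    case 0
    show ?case by (simp add: zero)
  next
    case (Suc n)
    show ?case
      by (simp add: add one Suc mod_add_right_eq del: of_nat_mod)
  qed
  have "(of_nat n = (0 :: 'f)) \<longleftrightarrow> p dvd n" for n
  proof -
    have "(of_nat n = (0 :: 'f)) \<longleftrightarrow> h (of_nat n) = h 0"
      using inj by (auto dest: injD)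
    also have "\<dots> \<longleftrightarrow> p dvd n"
      unfolding of_nat zero by (metis dvd_eq_mod_eq_0 int_dvd_int_iff)
    finally show ?thesis .
  qed
  then show ?thesis
    by (metis dvd_refl gcd_nat.antisym of_nat_CHAR of_nat_eq_0_iff_char_dvd)
qed

definition zero_in_F :: "'f :: field itself \<Rightarrow> int \<Rightarrow> bool" where
  "zero_in_F TYPE('f) n \<longleftrightarrow>
     (if CHAR('f) = 0 then n = 0 else [n = 0] (mod int CHAR('f)))"


section \<open>Generalized sign functions\<close>

text \<open>The additive subgroup generated by \<open>1\<close> is \<^term>\<open>\<int>\<close>, the range of \<^const>\<open>of_int\<close>.\<close>

definition generalized_sign_function ::
  "('v, 'e) pre_digraph \<Rightarrow> ('e \<Rightarrow> ('v \<times> 'f :: field) set set) \<Rightarrow> ('e \<Rightarrow> 'f) \<Rightarrow> bool" where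
  "generalized_sign_function D C \<phi> \<longleftrightarrow>
     (\<forall>e \<in> arcs D. \<phi> e \<in> \<int> - {0} \<and>
        (\<exists>a. \<forall>c1 c2. {(tail D e, c1), (head D e, c2)} \<in> C e \<longrightarrow> c1 - \<phi> e * c2 = a))"

definition sign_decomposition ::
  "'e set \<Rightarrow> ('e \<Rightarrow> 'f :: field) \<Rightarrow> ('e \<Rightarrow> int) \<Rightarrow> ('e \<Rightarrow> nat) \<Rightarrow> bool" where
  "sign_decomposition E \<phi> \<sigma> \<psi> \<longleftrightarrow>
     (\<forall>e \<in> E.
        if CHAR('f) = 0
        then \<exists>n :: int. \<phi> e = of_int n \<and> \<sigma> e = sgn n \<and> int (\<psi> e) = \<bar>n\<bar>
        else \<sigma> e \<in> {1, -1} \<and> \<psi> e \<in> {1..CHAR('f) - 1} \<and> \<phi> e = of_int (\<sigma> e) * of_nat (\<psi> e))"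


section \<open>The auxiliary digraph\<close>

text \<open>For an arc \<open>e\<close> from \<open>v\<close> to \<open>w\<close>, the new vertices next to \<open>v\<close> and \<open>w\<close> are \<open>Near_Tail e\<close>
  and \<open>Near_Head e\<close>.\<close>

datatype ('v, 'e) aux_vert = Old 'v | Near_Tail 'e | Near_Head 'e | Middle 'e nat

datatype 'e aux_arc =
    From_Tail 'e
  | To_Head 'e
  | Parallel 'e nat
  | To_Middle 'e nat
  | From_Middle 'e nat

fun aux_tail :: "('v, 'e) pre_digraph \<Rightarrow> 'e aux_arc \<Rightarrow> ('v, 'e) aux_vert" where
  "aux_tail D (From_Tail e) = Old (tail D e)"
| "aux_tail D (To_Head e) = Near_Head e"
| "aux_tail D (Parallel e i) = Near_Tail e"
| "aux_tail D (To_Middle e i) = Near_Tail e"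
| "aux_tail D (From_Middle e i) = Middle e i"

fun aux_head :: "('v, 'e) pre_digraph \<Rightarrow> 'e aux_arc \<Rightarrow> ('v, 'e) aux_vert" where
  "aux_head D (From_Tail e) = Near_Tail e"
| "aux_head D (To_Head e) = Old (head D e)"
| "aux_head D (Parallel e i) = Near_Head e"
| "aux_head D (To_Middle e i) = Middle e i"
| "aux_head D (From_Middle e i) = Near_Head e"

definition aux_digraph ::
  "('v, 'e) pre_digraph \<Rightarrow> ('e \<Rightarrow> int) \<Rightarrow> ('e \<Rightarrow> nat) \<Rightarrow> (('v, 'e) aux_vert, 'e aux_arc) pre_digraph"
where
  "aux_digraph D \<sigma> \<psi> =
     \<lparr> verts = Old ` verts D \<union> Near_Tail ` arcs D \<union> Near_Head ` arcs D
         \<union> {Middle e i |e i. e \<in> arcs D \<and> \<sigma> e = -1 \<and> i \<in> {1..\<psi> e}},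
       arcs = From_Tail ` arcs D \<union> To_Head ` arcs D
         \<union> {Parallel e i |e i. e \<in> arcs D \<and> \<sigma> e = 1 \<and> i \<in> {1..\<psi> e}}
         \<union> {To_Middle e i |e i. e \<in> arcs D \<and> \<sigma> e = -1 \<and> i \<in> {1..\<psi> e}}
         \<union> {From_Middle e i |e i. e \<in> arcs D \<and> \<sigma> e = -1 \<and> i \<in> {1..\<psi> e}},
       tail = aux_tail D,
       head = aux_head D \<rparr>"

end

theory Submission
  imports Defs
begin

text \<open>Every conflict on an arc \<open>e\<close> from \<open>v\<close> to \<open>w\<close> is a zero of the linear factor
  \<open>x\<^sub>v - \<phi> e x\<^sub>w - a e\<close>, so a point of the grid of lists at which the product of these factors does
  not vanish is a coloring. By the Combinatorial Nullstellensatz such a point exists once the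
  coefficient of the top-degree monomial with exponents \<open>out_degree D v\<close> is nonzero. The
  contributions to it correspond to the Eulerian subdigraphs \<open>S\<close> of \<open>D\<close> (the arcs at which the
  head is chosen), each with weight \<open>\<Prod>e\<in>S. - \<sigma> e * \<psi> e\<close>. In the auxiliary digraph every
  such \<open>S\<close> lifts to \<open>\<Prod>e\<in>S. \<psi> e\<close> Eulerian subdigraphs, where passing along \<open>e\<close> uses three arcs
  if \<open>\<sigma> e = 1\<close> and four if \<open>\<sigma> e = -1\<close>, so that the coefficient is \<open>EE - EO\<close>.\<close>

section \<open>Lagrange interpolation and the Combinatorial Nullstellensatz\<close>

text \<open>The sum is the coefficient of \<open>x ^ d\<close> in the Lagrange interpolant of
  \<open>x ^ k\<close> on the \<open>d + 1\<close> points of \<open>A\<close>. Since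
  \<open>k \<le> d\<close>, this interpolant is \<open>x ^ k\<close> itself.\<close>

lemma sum_power_divided_difference:
  fixes A :: "'a :: field set"
  assumes "finite A" "card A = Suc d" "k \<le> d"
  shows "(\<Sum>c\<in>A. c ^ k / (\<Prod>b\<in>A - {c}. c - b)) = (if k = d then 1 else 0)"
proof -
  \<comment> \<open>The numerators \<open>l c\<close> of the Lagrange basis are monic of degree
    \<open>d\<close>, and \<open>w c\<close> is the value of \<open>l c\<close> at
    \<open>c\<close>.\<close>
  define l where "l c = (\<Prod>b\<in>A - {c}. [:- b, 1:])" for c
  define w where "w c = (\<Prod>b\<in>A - {c}. c - b)" for c
  have deg: "degree (l c) = d" and lead: "coeff (l c) d = 1" if "c \<in> A" for c
  proof -
    have "degree (l c) = (\<Sum>b\<in>A - {c}. degree [:- b, 1:])"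
      unfolding l_def by (rule degree_prod_eq_sum_degree) auto
    then show deg: "degree (l c) = d"
      using assms that by simp
    have "lead_coeff (l c) = 1"
      unfolding l_def lead_coeff_prod by simp
    with deg show "coeff (l c) d = 1" by simp
  qed
  have val: "poly (l c) x = (if x = c then w c else 0)" if "c \<in> A" "x \<in> A" for c x
    using assms that by (auto simp: l_def w_def poly_prod)
  have w0: "w c \<noteq> 0" if "c \<in> A" for c
    using assms that by (auto simp: w_def)
  define q where "q = (\<Sum>c\<in>A. smult (c ^ k / w c) (l c))"
  have "poly q x = x ^ k" if "x \<in> A" for x
  proof -
    have "poly q x = (\<Sum>c\<in>A. if x = c then x ^ k else 0)"
      unfolding q_def poly_sum using val w0 that by (intro sum.cong) auto
    then show ?thesis using assms that by simp
  qed
  then have roots: "A \<subseteq> {x. poly (q - monom 1 k) x = 0}"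
    by (auto simp: poly_monom)
  have "degree (q - monom 1 k) \<le> d"
    unfolding q_def using deg assms
    by (intro degree_diff_le degree_sum_le order.trans[OF degree_smult_le])
      (auto simp: degree_monom_eq)
  \<comment> \<open>A nonzero polynomial of degree at most \<open>d\<close> cannot vanish at the
    \<open>d + 1\<close> points of \<open>A\<close>.\<close>
  then have "q - monom 1 k = 0"
    using card_poly_roots_bound[of "q - monom 1 k"] poly_roots_finite[of "q - monom 1 k"]
      card_mono[OF _ roots] assms by fastforce
  then have "coeff q d = coeff (monom 1 k) d" by simp
  moreover have "coeff q d = (\<Sum>c\<in>A. c ^ k / w c)"
    unfolding q_def coeff_sum using lead by (intro sum.cong) auto
  ultimately show ?thesis unfolding w_def by auto
qed

text \<open>Summing against the weights of Lagrange interpolation on the grid extracts the coefficient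
  of the top monomial.\<close>

lemma coefficient_nullstellensatz:
  fixes A :: "'v \<Rightarrow> 'a :: field set" and c :: "'i \<Rightarrow> 'a"
  assumes "finite V" "finite I"
    and A: "\<And>v. v \<in> V \<Longrightarrow> finite (A v) \<and> card (A v) = Suc (d v)"
    and le: "\<And>i. i \<in> I \<Longrightarrow> (\<Sum>v\<in>V. k i v) \<le> (\<Sum>v\<in>V. d v)"
    and nz: "(\<Sum>i | i \<in> I \<and> (\<forall>v\<in>V. k i v = d v). c i) \<noteq> 0"
  obtains f where "f \<in> PiE V A" "(\<Sum>i\<in>I. c i * (\<Prod>v\<in>V. f v ^ k i v)) \<noteq> 0"
proof -
  \<comment> \<open>By \<open>sum_power_divided_difference\<close>, summing over \<open>A v\<close>
    against \<open>w v\<close> sends the \<open>d v\<close>-th power to 1 and every lower power to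
    0.\<close>
  define w where "w v x = 1 / (\<Prod>b\<in>A v - {x}. x - b)" for v x
  have mono: "(\<Sum>f\<in>PiE V A. \<Prod>v\<in>V. w v (f v) * f v ^ k i v) = (if \<forall>v\<in>V. k i v = d v then 1 else 0)"
    if i: "i \<in> I" for i
  proof -
    have *: "(\<Sum>x\<in>A v. w v x * x ^ k i v) = (if k i v = d v then 1 else 0)"
      if "v \<in> V" "k i v \<le> d v" for v
      using sum_power_divided_difference[of "A v" "d v" "k i v"] A that by (simp add: w_def)
    have "(\<Sum>f\<in>PiE V A. \<Prod>v\<in>V. w v (f v) * f v ^ k i v) = (\<Prod>v\<in>V. \<Sum>x\<in>A v. w v x * x ^ k i v)"
      using A \<open>finite V\<close> by (subst prod_sum_PiE) auto
    also have "\<dots> = (if \<forall>v\<in>V. k i v = d v then 1 else 0)"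
    proof (cases "\<forall>v\<in>V. k i v = d v")
      case True
      then show ?thesis using * by auto
    next
      case False
      \<comment> \<open>The weights say nothing about exponents above \<open>d v\<close>. The bound
        on the total degree forces some other exponent below its \<open>d v\<close>, and that single
        vanishing factor kills the product.\<close>
      have "\<exists>v\<in>V. k i v < d v"
      proof (rule ccontr)
        assume "\<not> ?thesis"
        then have ge: "\<forall>v\<in>V. d v \<le> k i v" by auto
        with False have "(\<Sum>v\<in>V. d v) < (\<Sum>v\<in>V. k i v)"
          using \<open>finite V\<close> by (intro sum_strict_mono_ex1) (auto simp: order.strict_iff_order eq_commute)
        with le[OF i] show False by simp
      qed
      then obtain v where "v \<in> V" "k i v < d v" by blast
      with * have "(\<Sum>x\<in>A v. w v x * x ^ k i v) = 0" by simp
      with False \<open>finite V\<close> \<open>v \<in> V\<close> show ?thesis by (auto simp: prod_zero_iff)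
    qed
    finally show ?thesis .
  qed
  have "(\<Sum>f\<in>PiE V A. (\<Prod>v\<in>V. w v (f v)) * (\<Sum>i\<in>I. c i * (\<Prod>v\<in>V. f v ^ k i v)))
      = (\<Sum>f\<in>PiE V A. \<Sum>i\<in>I. c i * (\<Prod>v\<in>V. w v (f v) * f v ^ k i v))"
    by (simp add: sum_distrib_left prod.distrib mult_ac)
  also have "\<dots> = (\<Sum>i\<in>I. c i * (\<Sum>f\<in>PiE V A. \<Prod>v\<in>V. w v (f v) * f v ^ k i v))"
    by (subst sum.swap) (simp add: sum_distrib_left)
  also have "\<dots> = (\<Sum>i\<in>I. if \<forall>v\<in>V. k i v = d v then c i else 0)"
    using mono by (intro sum.cong) auto
  also have "\<dots> = (\<Sum>i | i \<in> I \<and> (\<forall>v\<in>V. k i v = d v). c i)"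
    using \<open>finite I\<close> by (rule sum.inter_filter [symmetric])
  finally have "(\<Sum>f\<in>PiE V A. (\<Prod>v\<in>V. w v (f v)) * (\<Sum>i\<in>I. c i * (\<Prod>v\<in>V. f v ^ k i v))) \<noteq> 0"
    using nz by simp
  then obtain f where "f \<in> PiE V A" "(\<Sum>i\<in>I. c i * (\<Prod>v\<in>V. f v ^ k i v)) \<noteq> 0"
    by (metis (no_types, lifting) mult_zero_right sum.neutral)
  then show thesis by (rule that)
qed

section \<open>Counting arcs by their endpoints\<close>

lemma prod_fibres_power:
  fixes f :: "'v \<Rightarrow> 'a :: comm_monoid_mult"
  assumes "finite S" "finite V" "g ` S \<subseteq> V"
  shows "(\<Prod>e\<in>S. f (g e)) = (\<Prod>v\<in>V. f v ^ card {e \<in> S. g e = v})"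
proof -
  have "(\<Prod>e\<in>S. f (g e)) = (\<Prod>v\<in>V. \<Prod>e\<in>{e \<in> S. g e = v}. f (g e))"
    by (rule prod.group [OF assms, symmetric])
  also have "\<dots> = (\<Prod>v\<in>V. f v ^ card {e \<in> S. g e = v})"
    by (intro prod.cong) auto
  finally show ?thesis .
qed

lemma sum_card_fibres:
  assumes "finite S" "finite V" "g ` S \<subseteq> V"
  shows "(\<Sum>v\<in>V. card {e \<in> S. g e = v}) = card S"
  using sum.group [OF assms, of "\<lambda>_. 1 :: nat"] by simp

section \<open>Eulerian subdigraphs as arc sets\<close>

text \<open>This is the Eulerian condition expressed through arcs alone: a spanning subdigraph
  shares vertices, \<open>tail\<close> and \<open>head\<close> with \<open>D\<close>, so its arc set
  determines it.\<close>

definition balanced_arcs :: "('a, 'b) pre_digraph \<Rightarrow> 'b set \<Rightarrow> bool" where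
  "balanced_arcs D B \<longleftrightarrow>
     (\<forall>v\<in>verts D. card {e \<in> B. tail D e = v} = card {e \<in> B. head D e = v})"

lemma EE_minus_EO:
  assumes "fin_digraph D"
  shows "int (EE D) - int (EO D) = (\<Sum>B | B \<subseteq> arcs D \<and> balanced_arcs D B. (- 1) ^ card B)"
proof -
  interpret fin_digraph D by fact
  define S where "S = {B. B \<subseteq> arcs D \<and> balanced_arcs D B}"
  have fin: "finite S"
    unfolding S_def by simp
  define h where "h B = D \<lparr>arcs := B\<rparr>" for B
  have inj: "inj_on h T" for T
    by (rule inj_onI) (metis h_def pre_digraph.select_convs(2) pre_digraph.surjective
        pre_digraph.update_convs(2))
  \<comment> \<open>The predicate \<open>P\<close> is kept arbitrary so that one bijection serves
    both parities.\<close>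
  have *: "{H. spanning H D \<and> eulerian_digraph H \<and> P (card (arcs H))} = h ` {B \<in> S. P (card B)}" for P
  proof (intro equalityI subsetI)
    fix H assume "H \<in> {H. spanning H D \<and> eulerian_digraph H \<and> P (card (arcs H))}"
    then have H: "verts H = verts D" "tail H = tail D" "head H = head D" "arcs H \<subseteq> arcs D"
      "eulerian_digraph H" "P (card (arcs H))"
      by (auto simp: spanning_def subgraph_def compatible_def)
    then have "H = h (arcs H)"
      by (auto simp: h_def)
    moreover have "arcs H \<in> S"
      using H by (auto simp: S_def balanced_arcs_def eulerian_digraph_def out_degree_def
          in_degree_def out_arcs_def in_arcs_def)
    ultimately show "H \<in> h ` {B \<in> S. P (card B)}"
      using H by blast
  next
    fix H assume "H \<in> h ` {B \<in> S. P (card B)}"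
    then obtain B where B: "H = h B" "B \<in> S" "P (card B)" by auto
    have "wf_digraph H"
      using B by unfold_locales (auto simp: h_def S_def)
    with B wf_digraph show "H \<in> {H. spanning H D \<and> eulerian_digraph H \<and> P (card (arcs H))}"
      by (auto simp: h_def S_def spanning_def subgraph_def compatible_def balanced_arcs_def
          eulerian_digraph_def out_degree_def in_degree_def out_arcs_def in_arcs_def)
  qed
  have "int (EE D) - int (EO D) = int (card {B \<in> S. even (card B)}) - int (card {B \<in> S. odd (card B)})"
    unfolding EE_def EO_def *[of even] *[of odd] by (simp add: card_image inj)
  also have "\<dots> = (\<Sum>B\<in>S. (if even (card B) then 1 else 0)) - (\<Sum>B\<in>S. (if odd (card B) then 1 else 0))"
    using fin by (simp flip: sum.inter_filter)
  also have "\<dots> = (\<Sum>B\<in>S. (- 1) ^ card B)"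
    unfolding sum_subtractf [symmetric] by (intro sum.cong) auto
  finally show ?thesis unfolding S_def .
qed

section \<open>Eulerian subdigraphs of the auxiliary digraph\<close>

text \<open>The arcs of the auxiliary digraph traversed when passing along \<open>e\<close> through its \<open>i\<close>-th
  parallel branch; \<open>i = 0\<close> stands for not using \<open>e\<close>.\<close>

definition route :: "('e \<Rightarrow> int) \<Rightarrow> 'e \<Rightarrow> nat \<Rightarrow> 'e aux_arc set" where
  "route \<sigma> e i =
     (if i = 0 then {}
      else if \<sigma> e = 1 then {From_Tail e, Parallel e i, To_Head e}
      else {From_Tail e, To_Middle e i, From_Middle e i, To_Head e})"

definition routed_arcs :: "('e \<Rightarrow> int) \<Rightarrow> 'e set \<Rightarrow> ('e \<Rightarrow> nat) \<Rightarrow> 'e aux_arc set" where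
  "routed_arcs \<sigma> E g = (\<Union>e\<in>E. route \<sigma> e (g e))"

lemma routed_arcs_iff:
  "From_Tail e \<in> routed_arcs \<sigma> E g \<longleftrightarrow> e \<in> E \<and> g e \<noteq> 0"
  "To_Head e \<in> routed_arcs \<sigma> E g \<longleftrightarrow> e \<in> E \<and> g e \<noteq> 0"
  "Parallel e i \<in> routed_arcs \<sigma> E g \<longleftrightarrow> e \<in> E \<and> i \<noteq> 0 \<and> g e = i \<and> \<sigma> e = 1"
  "To_Middle e i \<in> routed_arcs \<sigma> E g \<longleftrightarrow> e \<in> E \<and> i \<noteq> 0 \<and> g e = i \<and> \<sigma> e \<noteq> 1"
  "From_Middle e i \<in> routed_arcs \<sigma> E g \<longleftrightarrow> e \<in> E \<and> i \<noteq> 0 \<and> g e = i \<and> \<sigma> e \<noteq> 1"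
  by (auto simp: routed_arcs_def route_def split: if_splits)

text \<open>Routes of distinct edges are disjoint. A nonempty route has three arcs for sign 1 and
  four for sign -1, so it contributes the factor \<open>- \<sigma> e\<close> in both cases.\<close>

lemma sign_card_routed_arcs:
  assumes "finite E" "\<forall>e\<in>E. \<sigma> e \<in> {1, - 1}"
  shows "(- 1) ^ card (routed_arcs \<sigma> E g) = (\<Prod>e\<in>E. if g e = 0 then 1 else - \<sigma> e)"
proof -
  have "card (routed_arcs \<sigma> E g) = (\<Sum>e\<in>E. card (route \<sigma> e (g e)))"
    unfolding routed_arcs_def using assms by (intro card_UN_disjoint) (auto simp: route_def)
  then have "(- 1) ^ card (routed_arcs \<sigma> E g) = (\<Prod>e\<in>E. (- 1 :: int) ^ card (route \<sigma> e (g e)))"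
    by (simp add: power_sum)
  also have "\<dots> = (\<Prod>e\<in>E. if g e = 0 then 1 else - \<sigma> e)"
    using assms by (intro prod.cong) (auto simp: route_def)
  finally show ?thesis .
qed

lemma finite_dependent_pairs:
  assumes "finite A"
  shows "finite {c e i |e i. e \<in> A \<and> P e \<and> i \<in> {m..n e :: nat}}"
proof -
  have "finite (case_prod c ` (SIGMA e:A. {m..n e}))"
    using assms by simp
  then show ?thesis by (rule finite_subset [rotated]) auto
qed

lemma fin_digraph_aux_digraph:
  assumes "fin_digraph D"
  shows "fin_digraph (aux_digraph D \<sigma> \<psi>)"
proof -
  interpret fin_digraph D by fact
  show ?thesis
    by unfold_locales
      (auto simp: aux_digraph_def simp del: atLeastAtMost_iff intro!: finite_dependent_pairs)
qed

text \<open>A route enters and leaves each new vertex on it exactly once, so only the old vertices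
  impose conditions. There the outer arcs of the routes correspond to the arcs of \<open>D\<close>
  with \<open>g e \<noteq> 0\<close>.\<close>

lemma balanced_routed_arcs:
  assumes "g \<in> (\<Pi>\<^sub>E e\<in>arcs D. {0..\<psi> e})"
  shows "balanced_arcs (aux_digraph D \<sigma> \<psi>) (routed_arcs \<sigma> (arcs D) g) \<longleftrightarrow>
    balanced_arcs D {e \<in> arcs D. g e \<noteq> 0}"
proof -
  let ?R = "routed_arcs \<sigma> (arcs D) g" and ?S = "{e \<in> arcs D. g e \<noteq> 0}"
  note iff = routed_arcs_iff [where \<sigma> = \<sigma> and E = "arcs D" and g = g]
  have sets:
    "{a \<in> ?R. aux_tail D a = Old v} = From_Tail ` {e \<in> ?S. tail D e = v}"
    "{a \<in> ?R. aux_head D a = Old v} = To_Head ` {e \<in> ?S. head D e = v}"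
    "{a \<in> ?R. aux_tail D a = Near_Tail e} =
      (if e \<in> ?S then {if \<sigma> e = 1 then Parallel e (g e) else To_Middle e (g e)} else {})"
    "{a \<in> ?R. aux_head D a = Near_Tail e} = (if e \<in> ?S then {From_Tail e} else {})"
    "{a \<in> ?R. aux_head D a = Near_Head e} =
      (if e \<in> ?S then {if \<sigma> e = 1 then Parallel e (g e) else From_Middle e (g e)} else {})"
    "{a \<in> ?R. aux_tail D a = Near_Head e} = (if e \<in> ?S then {To_Head e} else {})"
    "{a \<in> ?R. aux_tail D a = Middle e i} =
      (if e \<in> ?S \<and> g e = i \<and> \<sigma> e \<noteq> 1 then {From_Middle e i} else {})"
    "{a \<in> ?R. aux_head D a = Middle e i} =
      (if e \<in> ?S \<and> g e = i \<and> \<sigma> e \<noteq> 1 then {To_Middle e i} else {})" for v e i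
    by (rule Set.set_eqI; case_tac x; auto simp: iff)+
  have card_old:
    "card {a \<in> ?R. aux_tail D a = Old v} = card {e \<in> ?S. tail D e = v}"
    "card {a \<in> ?R. aux_head D a = Old v} = card {e \<in> ?S. head D e = v}" for v
    unfolding sets by (simp_all add: card_image inj_on_def)
  have card_new:
    "card {a \<in> ?R. aux_tail D a = x} = card {a \<in> ?R. aux_head D a = x}" if "\<forall>v. x \<noteq> Old v" for x
    using that by (cases x) (simp_all add: sets del: mem_Collect_eq)
  have "balanced_arcs (aux_digraph D \<sigma> \<psi>) ?R \<longleftrightarrow>
      (\<forall>v\<in>verts D. card {a \<in> ?R. aux_tail D a = Old v} = card {a \<in> ?R. aux_head D a = Old v})"
    unfolding balanced_arcs_def by (auto simp: aux_digraph_def card_new)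
  then show ?thesis
    unfolding card_old balanced_arcs_def .
qed

text \<open>Only \<open>From_Tail e\<close> enters \<open>Near_Tail e\<close> and only
  \<open>To_Head e\<close> leaves \<open>Near_Head e\<close>. Balance therefore permits at most one
  branch per edge, and a branch in use brings its whole route with it.\<close>

lemma balanced_arcs_routed:
  assumes "fin_digraph D" and \<sigma>: "\<forall>e\<in>arcs D. \<sigma> e \<in> {1, - 1}"
    and sub: "B \<subseteq> arcs (aux_digraph D \<sigma> \<psi>)" and bal: "balanced_arcs (aux_digraph D \<sigma> \<psi>) B"
  obtains g where "g \<in> (\<Pi>\<^sub>E e\<in>arcs D. {0..\<psi> e})" "B = routed_arcs \<sigma> (arcs D) g"
proof -
  interpret aux: fin_digraph "aux_digraph D \<sigma> \<psi>"
    using assms(1) by (rule fin_digraph_aux_digraph)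
  have finB: "finite B"
    using sub by (rule finite_subset) simp
  have mem:
    "From_Tail e \<in> B \<Longrightarrow> e \<in> arcs D"
    "To_Head e \<in> B \<Longrightarrow> e \<in> arcs D"
    "Parallel e i \<in> B \<Longrightarrow> e \<in> arcs D \<and> \<sigma> e = 1 \<and> i \<in> {1..\<psi> e}"
    "To_Middle e i \<in> B \<Longrightarrow> e \<in> arcs D \<and> \<sigma> e = - 1 \<and> i \<in> {1..\<psi> e}"
    "From_Middle e i \<in> B \<Longrightarrow> e \<in> arcs D \<and> \<sigma> e = - 1 \<and> i \<in> {1..\<psi> e}" for e i
    using sub by (auto simp: aux_digraph_def)
  have bal': "card {a \<in> B. aux_tail D a = x} = card {a \<in> B. aux_head D a = x}"
    if "x \<in> verts (aux_digraph D \<sigma> \<psi>)" for x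
    using bal that by (simp add: balanced_arcs_def aux_digraph_def)
  \<comment> \<open>\<open>first e i\<close> and \<open>last e i\<close> are the arcs of branch
    \<open>i\<close> at \<open>Near_Tail e\<close> and \<open>Near_Head e\<close>; for sign 1 they
    coincide. This treats both signs uniformly.\<close>
  define first where "first e i = (if \<sigma> e = 1 then Parallel e i else To_Middle e i)" for e i
  define last where "last e i = (if \<sigma> e = 1 then Parallel e i else From_Middle e i)" for e i
  have middle: "From_Middle e i \<in> B \<longleftrightarrow> To_Middle e i \<in> B" for e i
  proof (cases "Middle e i \<in> verts (aux_digraph D \<sigma> \<psi>)")
    case True
    have "{a \<in> B. aux_tail D a = Middle e i} = (if From_Middle e i \<in> B then {From_Middle e i} else {})"
      "{a \<in> B. aux_head D a = Middle e i} = (if To_Middle e i \<in> B then {To_Middle e i} else {})"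
      by (rule Set.set_eqI; case_tac x; auto)+
    with bal'[OF True] show ?thesis by (auto split: if_splits)
  next
    case False
    then show ?thesis using mem(4,5)[of e i] by (auto simp: aux_digraph_def)
  qed
  have first_last: "first e i \<in> B \<longleftrightarrow> last e i \<in> B" for e i
    using middle by (simp add: first_def last_def)
  have inj: "inj_on (first e) T" "inj_on (last e) T" for e T
    by (auto simp: inj_on_def first_def last_def)
  have card_from: "card {i. first e i \<in> B} = (if From_Tail e \<in> B then 1 else 0)"
    and card_to: "card {i. last e i \<in> B} = (if To_Head e \<in> B then 1 else 0)"
    if e: "e \<in> arcs D" for e
  proof -
    have *: "{a \<in> B. aux_tail D a = Near_Tail e} = first e ` {i. first e i \<in> B}"
      "{a \<in> B. aux_head D a = Near_Head e} = last e ` {i. last e i \<in> B}"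
      by (rule Set.set_eqI; case_tac x; use mem in \<open>fastforce simp: first_def last_def image_iff\<close>)+
    have **: "{a \<in> B. aux_head D a = Near_Tail e} = (if From_Tail e \<in> B then {From_Tail e} else {})"
      "{a \<in> B. aux_tail D a = Near_Head e} = (if To_Head e \<in> B then {To_Head e} else {})"
      by (rule Set.set_eqI; case_tac x; auto)+
    show "card {i. first e i \<in> B} = (if From_Tail e \<in> B then 1 else 0)"
      using bal'[of "Near_Tail e"] e unfolding * ** card_image[OF inj(1)]
      by (cases "To_Head e \<in> B"; cases "From_Tail e \<in> B") (simp_all add: aux_digraph_def)
    show "card {i. last e i \<in> B} = (if To_Head e \<in> B then 1 else 0)"
      using bal'[of "Near_Head e"] e unfolding * ** card_image[OF inj(2)]
      by (cases "To_Head e \<in> B"; cases "From_Tail e \<in> B") (simp_all add: aux_digraph_def)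
  qed
  have to_from: "To_Head e \<in> B \<longleftrightarrow> From_Tail e \<in> B" if "e \<in> arcs D" for e
    using card_from[OF that] card_to[OF that] unfolding first_last
    by (cases "To_Head e \<in> B"; cases "From_Tail e \<in> B") simp_all
  \<comment> \<open>Needed to conclude emptiness from cardinality 0, since \<open>card\<close> is
    also 0 on infinite sets.\<close>
  have fin: "finite {i. first e i \<in> B}" for e
    using finite_vimageI[OF finB inj(1)[of e UNIV]] by (simp add: vimage_def)
  define g where "g = (\<lambda>e\<in>arcs D. if From_Tail e \<in> B then THE i. first e i \<in> B else 0)"
  have g: "first e i \<in> B \<longleftrightarrow> i = g e" if e: "e \<in> arcs D" "From_Tail e \<in> B" for e i
  proof -
    have "card {i. first e i \<in> B} = 1"
      using card_from[OF e(1)] e(2) by simp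
    then obtain j where j: "{i. first e i \<in> B} = {j}"
      by (rule card_1_singletonE)
    then have "(THE i. first e i \<in> B) = j" by (intro the_equality) auto
    then show ?thesis using j e by (auto simp: g_def)
  qed
  have g0: "first e i \<notin> B" "g e = 0" if "e \<in> arcs D" "From_Tail e \<notin> B" for e i
    using card_from[OF that(1)] that fin[of e] by (auto simp: g_def)
  have pos: "i \<in> {1..\<psi> e}" if "first e i \<in> B" for e i
    using mem(3,4)[of e i] that by (auto simp: first_def split: if_splits)
  have g_pos: "g e \<in> {1..\<psi> e}" if "e \<in> arcs D" "From_Tail e \<in> B" for e
    using g[OF that] pos by blast
  have "g \<in> (\<Pi>\<^sub>E e\<in>arcs D. {0..\<psi> e})"
  proof (rule PiE_I)
    fix e assume "e \<in> arcs D"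
    then show "g e \<in> {0..\<psi> e}" using g_pos[of e] g0(2)[of e] by (cases "From_Tail e \<in> B") auto
  qed (simp add: g_def)
  moreover have from_iff: "From_Tail e \<in> B \<longleftrightarrow> e \<in> arcs D \<and> g e \<noteq> 0" for e
    using g_pos[of e] g0(2)[of e] mem(1)[of e] by (cases "From_Tail e \<in> B") auto
  have to_iff: "To_Head e \<in> B \<longleftrightarrow> e \<in> arcs D \<and> g e \<noteq> 0" for e
    using to_from[of e] from_iff[of e] mem(2)[of e] by auto
  have first_iff: "first e i \<in> B \<longleftrightarrow> i \<noteq> 0 \<and> g e = i" if "e \<in> arcs D" for e i
    using g[OF that, of i] g0(1)[OF that, of i] g0(2)[OF that] g_pos[OF that] by (cases "From_Tail e \<in> B") auto
  have par_iff: "Parallel e i \<in> B \<longleftrightarrow> e \<in> arcs D \<and> i \<noteq> 0 \<and> g e = i \<and> \<sigma> e = 1" for e i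
    using first_iff[of e i] mem(3)[of e i] by (auto simp: first_def)
  have mid_iff: "To_Middle e i \<in> B \<longleftrightarrow> e \<in> arcs D \<and> i \<noteq> 0 \<and> g e = i \<and> \<sigma> e \<noteq> 1" for e i
    using first_iff[of e i] mem(4)[of e i] \<sigma> by (auto simp: first_def)
  have "a \<in> B \<longleftrightarrow> a \<in> routed_arcs \<sigma> (arcs D) g" for a
    by (cases a) (simp_all only: from_iff to_iff par_iff mid_iff middle routed_arcs_iff)
  then have "B = routed_arcs \<sigma> (arcs D) g" by blast
  ultimately show thesis by (rule that)
qed

text \<open>\<open>routed_arcs\<close> is a bijection from the functions \<open>g\<close> in the
  index set onto the balanced arc sets of the auxiliary digraph, and
  \<open>sign_card_routed_arcs\<close> evaluates the signs.\<close>

lemma EE_minus_EO_aux_digraph: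
  assumes "fin_digraph D" and \<sigma>: "\<forall>e\<in>arcs D. \<sigma> e \<in> {1, - 1}"
  shows "int (EE (aux_digraph D \<sigma> \<psi>)) - int (EO (aux_digraph D \<sigma> \<psi>)) =
    (\<Sum>g | g \<in> (\<Pi>\<^sub>E e\<in>arcs D. {0..\<psi> e}) \<and> balanced_arcs D {e \<in> arcs D. g e \<noteq> 0}.
       \<Prod>e\<in>arcs D. if g e = 0 then 1 else - \<sigma> e)"
    (is "_ = sum _ ?T")
proof -
  interpret fin_digraph D by fact
  let ?A = "aux_digraph D \<sigma> \<psi>"
  \<comment> \<open>The arc \<open>From_Tail e\<close> reveals whether \<open>g e\<close> is 0;
    otherwise the \<open>Parallel\<close> or \<open>To_Middle\<close> arc reveals its value.\<close>
  have inj: "inj_on (routed_arcs \<sigma> (arcs D)) ?T"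
  proof (rule inj_onI)
    fix g h assume g: "g \<in> ?T" and h: "h \<in> ?T"
      and eq: "routed_arcs \<sigma> (arcs D) g = routed_arcs \<sigma> (arcs D) h"
    have "g e = h e" if "e \<in> arcs D" for e
    proof (cases "g e = 0")
      case True
      then show ?thesis
        using that eq routed_arcs_iff(1)[of e \<sigma> "arcs D" g] routed_arcs_iff(1)[of e \<sigma> "arcs D" h]
        by simp
    next
      case False
      then show ?thesis
        using that eq routed_arcs_iff(3,4)[of e "g e" \<sigma> "arcs D" g]
          routed_arcs_iff(3,4)[of e "g e" \<sigma> "arcs D" h]
        by metis
    qed
    then show "g = h" using g h by (auto intro: PiE_ext)
  qed
  have img: "{B. B \<subseteq> arcs ?A \<and> balanced_arcs ?A B} = routed_arcs \<sigma> (arcs D) ` ?T"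
  proof (intro equalityI subsetI)
    fix B assume "B \<in> {B. B \<subseteq> arcs ?A \<and> balanced_arcs ?A B}"
    then show "B \<in> routed_arcs \<sigma> (arcs D) ` ?T"
      using balanced_arcs_routed[OF assms, of B \<psi>] balanced_routed_arcs[of _ D \<psi> \<sigma>] by fastforce
  next
    fix B assume "B \<in> routed_arcs \<sigma> (arcs D) ` ?T"
    then obtain g where B: "B = routed_arcs \<sigma> (arcs D) g" and g: "g \<in> ?T" by auto
    have "a \<in> arcs ?A" if "a \<in> B" for a
      using that g \<sigma> unfolding B
      by (cases a) (auto simp: routed_arcs_iff aux_digraph_def PiE_iff)
    then show "B \<in> {B. B \<subseteq> arcs ?A \<and> balanced_arcs ?A B}"
      using g B balanced_routed_arcs[of g D \<psi> \<sigma>] by auto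
  qed
  show ?thesis
    unfolding EE_minus_EO[OF fin_digraph_aux_digraph[OF assms(1)]] img
      sum.reindex[OF inj] o_def sign_card_routed_arcs[OF finite_arcs \<sigma>] ..
qed

section \<open>Expansion of the product of linear factors\<close>

text \<open>A choice function \<open>g\<close> selects from each factor \<open>x\<^bsub>tail e\<^esub> - \<phi> e x\<^bsub>head e\<^esub> - a e\<close>, with
  \<open>\<phi> e = \<sigma> e * \<psi> e\<close>, one of the terms \<open>x\<^bsub>tail e\<^esub>\<close> (value \<open>0\<close>), the \<open>\<psi> e\<close> copies of
  \<open>- \<sigma> e x\<^bsub>head e\<^esub>\<close> (values \<open>1\<close> to \<open>\<psi> e\<close>), and \<open>- a e\<close> (value \<open>Suc (\<psi> e)\<close>).\<close>

definition choices :: "('v, 'e) pre_digraph \<Rightarrow> ('e \<Rightarrow> nat) \<Rightarrow> ('e \<Rightarrow> nat) set" where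
  "choices D \<psi> = (\<Pi>\<^sub>E e\<in>arcs D. {0..Suc (\<psi> e)})"

text \<open>This is the exponent of the variable of \<open>v\<close> in the term selected by
  \<open>g\<close>; the value \<open>Suc (\<psi> e)\<close> contributes no variable. The nested
  comprehensions match the shape of the fibre lemmas.\<close>

definition choice_exp :: "('v, 'e) pre_digraph \<Rightarrow> ('e \<Rightarrow> nat) \<Rightarrow> ('e \<Rightarrow> nat) \<Rightarrow> 'v \<Rightarrow> nat" where
  "choice_exp D \<psi> g v =
     card {e \<in> {e \<in> arcs D. g e = 0}. tail D e = v} +
     card {e \<in> {e \<in> arcs D. g e \<in> {1..\<psi> e}}. head D e = v}"

context fin_digraph
begin

lemma finite_choices: "finite (choices G \<psi>)"
  unfolding choices_def by (intro finite_PiE) auto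

lemma prod_choice:
  fixes f :: "'a \<Rightarrow> 'c :: comm_monoid_mult"
  shows "(\<Prod>e\<in>arcs G. if g e = 0 then f (tail G e) else if g e \<le> \<psi> e then f (head G e) else 1) =
    (\<Prod>v\<in>verts G. f v ^ choice_exp G \<psi> g v)"
proof -
  have "(\<Prod>e\<in>arcs G. if g e = 0 then f (tail G e) else if g e \<le> \<psi> e then f (head G e) else 1) =
      (\<Prod>e\<in>arcs G. (if g e = 0 then f (tail G e) else 1) *
        (if g e \<in> {1..\<psi> e} then f (head G e) else 1))"
    by (intro prod.cong) auto
  also have "\<dots> = (\<Prod>e | e \<in> arcs G \<and> g e = 0. f (tail G e)) *
      (\<Prod>e | e \<in> arcs G \<and> g e \<in> {1..\<psi> e}. f (head G e))"
    unfolding prod.distrib by (simp only: prod.inter_filter finite_arcs)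
  also have "\<dots> = (\<Prod>v\<in>verts G. f v ^ card {e \<in> {e \<in> arcs G. g e = 0}. tail G e = v}) *
      (\<Prod>v\<in>verts G. f v ^ card {e \<in> {e \<in> arcs G. g e \<in> {1..\<psi> e}}. head G e = v})"
    by (intro arg_cong2[where f = "(*)"] prod_fibres_power) auto
  finally show ?thesis
    by (simp add: choice_exp_def power_add prod.distrib)
qed

text \<open>Each factor whose constant term is not selected contributes exactly one variable, so the
  total degree counts these factors.\<close>

lemma sum_choice_exp:
  "(\<Sum>v\<in>verts G. choice_exp G \<psi> g v) = card {e \<in> arcs G. g e \<le> \<psi> e}"
proof -
  have "(\<Sum>v\<in>verts G. choice_exp G \<psi> g v) =
      card {e \<in> arcs G. g e = 0} + card {e \<in> arcs G. g e \<in> {1..\<psi> e}}"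
    unfolding choice_exp_def sum.distrib
    by (intro arg_cong2[where f = "(+)"] sum_card_fibres) auto
  also have "\<dots> = card {e \<in> arcs G. g e \<le> \<psi> e}"
    by (subst card_Un_disjoint [symmetric]) (auto intro: arg_cong[where f = card])
  finally show ?thesis .
qed

lemma sum_out_degree: "(\<Sum>v\<in>verts G. out_degree G v) = card (arcs G)"
  unfolding out_degree_def out_arcs_def by (intro sum_card_fibres) auto

lemma sum_choice_exp_le: "(\<Sum>v\<in>verts G. choice_exp G \<psi> g v) \<le> (\<Sum>v\<in>verts G. out_degree G v)"
  unfolding sum_choice_exp sum_out_degree by (intro card_mono) auto

text \<open>Full degree rules out constant terms. Removing from \<open>out_degree\<close> the arcs
  at which the tail is chosen leaves, at each vertex, as many tails as heads among the arcs with
  \<open>g e \<noteq> 0\<close>, which is balance.\<close>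

lemma top_choices:
  "{g \<in> choices G \<psi>. \<forall>v\<in>verts G. choice_exp G \<psi> g v = out_degree G v} =
    {g \<in> \<Pi>\<^sub>E e\<in>arcs G. {0..\<psi> e}. balanced_arcs G {e \<in> arcs G. g e \<noteq> 0}}"
proof -
  have no_const: "g \<in> (\<Pi>\<^sub>E e\<in>arcs G. {0..\<psi> e})"
    if "g \<in> choices G \<psi>" "\<forall>v\<in>verts G. choice_exp G \<psi> g v = out_degree G v" for g
  proof -
    have "card {e \<in> arcs G. g e \<le> \<psi> e} = card (arcs G)"
      using that(2) by (simp flip: sum_choice_exp sum_out_degree)
    then have "{e \<in> arcs G. g e \<le> \<psi> e} = arcs G"
      by (intro card_subset_eq) auto
    with that(1) show ?thesis by (auto simp: choices_def PiE_iff)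
  qed
  have eulerian: "(\<forall>v\<in>verts G. choice_exp G \<psi> g v = out_degree G v) \<longleftrightarrow>
      balanced_arcs G {e \<in> arcs G. g e \<noteq> 0}" if "g \<in> (\<Pi>\<^sub>E e\<in>arcs G. {0..\<psi> e})" for g
  proof -
    have "{e \<in> arcs G. g e \<in> {1..\<psi> e}} = {e \<in> arcs G. g e \<noteq> 0}"
      using that by (auto simp: PiE_iff)
    moreover have "out_degree G v = card {e \<in> {e \<in> arcs G. g e = 0}. tail G e = v} +
        card {e \<in> {e \<in> arcs G. g e \<noteq> 0}. tail G e = v}" for v
      unfolding out_degree_def out_arcs_def
      by (subst card_Un_disjoint [symmetric]) (auto intro: arg_cong[where f = card])
    ultimately show ?thesis
      by (auto simp: choice_exp_def balanced_arcs_def)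
  qed
  have "(\<Pi>\<^sub>E e\<in>arcs G. {0..\<psi> e}) \<subseteq> choices G \<psi>"
    unfolding choices_def by (intro PiE_mono) auto
  with no_const eulerian show ?thesis by blast
qed

end

section \<open>From the nonzero coefficient to a coloring\<close>

theorem theorem20:
  fixes G :: "('v, 'e) multigraph"
    and D :: "('v, 'e) pre_digraph"
    and L :: "'v \<Rightarrow> 'f :: field set"
    and C :: "'e \<Rightarrow> ('v \<times> 'f) set set"
    and \<phi> :: "'e \<Rightarrow> 'f"
    and \<sigma> :: "'e \<Rightarrow> int"
    and \<psi> :: "'e \<Rightarrow> nat"
  assumes "finite_loopless_multigraph G"
    and "CHAR('f) = 0 \<or> (\<exists>p. is_Zp TYPE('f) p)"
    and "correspondence_assignment G L C"
    and "is_orientation D G"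
    and "generalized_sign_function D C \<phi>"
    and "sign_decomposition (medges G) \<phi> \<sigma> \<psi>"
    and "\<not> zero_in_F TYPE('f) (int (EE (aux_digraph D \<sigma> \<psi>)) - int (EO (aux_digraph D \<sigma> \<psi>)))"
    and "\<forall>v \<in> mverts G. finite (L v) \<longrightarrow> card (L v) \<ge> out_degree D v + 1"
  shows "LC_colorable G L C"
proof -
  let ?V = "verts D" and ?E = "arcs D"
  interpret fin_digraph D
    using assms(1,4) by (rule orientation_loopfree_fin_digraph)
  have ends: "mends G e = {tail D e, head D e}" if "e \<in> ?E" for e
    using assms(4) that by (auto simp: is_orientation_def)
  have E: "medges G = ?E" and V: "mverts G = ?V"
    using assms(4) by (auto simp: is_orientation_def)
  have sign: "\<sigma> e \<in> {1, - 1}" and \<phi>: "\<phi> e = of_int (\<sigma> e) * of_nat (\<psi> e)" if e: "e \<in> ?E" for e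
  proof -
    have "\<sigma> e \<in> {1, - 1} \<and> \<phi> e = of_int (\<sigma> e) * of_nat (\<psi> e)"
    proof (cases "CHAR('f) = 0")
      case True
      then obtain n where n: "\<phi> e = of_int n" "\<sigma> e = sgn n" "int (\<psi> e) = \<bar>n\<bar>"
        using assms(6) e E by (auto simp: sign_decomposition_def)
      have "\<phi> e \<noteq> 0"
        using assms(5) e by (auto simp: generalized_sign_function_def)
      then have "n \<noteq> 0" using n by auto
      moreover have "of_nat (\<psi> e) = (of_int \<bar>n\<bar> :: 'f)"
        using n by (metis of_int_of_nat_eq)
      then have "of_int (\<sigma> e) * of_nat (\<psi> e) = (of_int (sgn n * \<bar>n\<bar>) :: 'f)"
        using n by simp
      ultimately show ?thesis
        using n by (auto simp: sgn_mult_abs sgn_if)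
    next
      case False
      then show ?thesis
        using assms(6) e E by (auto simp: sign_decomposition_def)
    qed
    then show "\<sigma> e \<in> {1, - 1}" "\<phi> e = of_int (\<sigma> e) * of_nat (\<psi> e)" by auto
  qed
  have "\<forall>e\<in>?E. \<exists>a. \<forall>c1 c2. {(tail D e, c1), (head D e, c2)} \<in> C e \<longrightarrow> c1 - \<phi> e * c2 = a"
    using assms(5) by (auto simp: generalized_sign_function_def)
  then obtain a where a: "\<And>e c1 c2. e \<in> ?E \<Longrightarrow> {(tail D e, c1), (head D e, c2)} \<in> C e \<Longrightarrow>
      c1 - \<phi> e * c2 = a e"
    by (metis (no_types))
  \<comment> \<open>The interpolation grid needs exactly \<open>out_degree D v + 1\<close> points at
    each vertex; infinite lists also contain such a subset.\<close>
  have "\<exists>A. A \<subseteq> L v \<and> finite A \<and> card A = Suc (out_degree D v)" if "v \<in> ?V" for v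
  proof (cases "finite (L v)")
    case True
    then have "Suc (out_degree D v) \<le> card (L v)" using assms(8) that V by auto
    then show ?thesis by (metis obtain_subset_with_card_n)
  next
    case False
    then show ?thesis by (metis infinite_arbitrarily_large)
  qed
  then obtain A where A: "\<And>v. v \<in> ?V \<Longrightarrow> A v \<subseteq> L v \<and> finite (A v) \<and> card (A v) = Suc (out_degree D v)"
    by metis
  define c where "c g = (\<Prod>e\<in>?E. if g e = 0 then 1 else if g e \<le> \<psi> e then - of_int (\<sigma> e) else - a e)"
    for g
  \<comment> \<open>The \<open>\<psi> e\<close> copies of \<open>- \<sigma> e\<close> times the head
    variable add up to the term with \<open>- \<phi> e\<close>; distributing the product over the
    sums then yields one monomial per choice function.\<close>
  have expand: "(\<Prod>e\<in>?E. f (tail D e) - \<phi> e * f (head D e) - a e) =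
      (\<Sum>g\<in>choices D \<psi>. c g * (\<Prod>v\<in>?V. f v ^ choice_exp D \<psi> g v))" for f
  proof -
    have "(\<Prod>e\<in>?E. f (tail D e) - \<phi> e * f (head D e) - a e) = (\<Prod>e\<in>?E. \<Sum>i = 0..Suc (\<psi> e).
        (if i = 0 then 1 else if i \<le> \<psi> e then - of_int (\<sigma> e) else - a e) *
        (if i = 0 then f (tail D e) else if i \<le> \<psi> e then f (head D e) else 1))"
    proof (intro prod.cong refl)
      fix e assume "e \<in> ?E"
      then show "f (tail D e) - \<phi> e * f (head D e) - a e = (\<Sum>i = 0..Suc (\<psi> e).
        (if i = 0 then 1 else if i \<le> \<psi> e then - of_int (\<sigma> e) else - a e) *
        (if i = 0 then f (tail D e) else if i \<le> \<psi> e then f (head D e) else 1))"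
        by (simp add: sum.atLeast_Suc_atMost \<phi> algebra_simps)
    qed
    also have "\<dots> = (\<Sum>g\<in>choices D \<psi>. c g *
        (\<Prod>e\<in>?E. if g e = 0 then f (tail D e) else if g e \<le> \<psi> e then f (head D e) else 1))"
      unfolding choices_def c_def prod.distrib [symmetric] by (rule prod_sum_PiE) auto
    finally show ?thesis by (simp add: prod_choice)
  qed
  \<comment> \<open>Without constant terms the coefficients do not involve \<open>a\<close> and are
    images of integers, which allows comparison with \<open>EE - EO\<close>.\<close>
  have top: "c g = of_int (\<Prod>e\<in>?E. if g e = 0 then 1 else - \<sigma> e)"
    if "g \<in> (\<Pi>\<^sub>E e\<in>?E. {0..\<psi> e})" for g
    using that unfolding c_def of_int_prod by (intro prod.cong) (auto simp: PiE_iff)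
  have \<sigma>: "\<forall>e\<in>?E. \<sigma> e \<in> {1, - 1}"
    using sign by blast
  have "(\<Sum>g | g \<in> choices D \<psi> \<and> (\<forall>v\<in>?V. choice_exp D \<psi> g v = out_degree D v). c g) =
      of_int (int (EE (aux_digraph D \<sigma> \<psi>)) - int (EO (aux_digraph D \<sigma> \<psi>)))"
    unfolding top_choices EE_minus_EO_aux_digraph[OF fin_digraph_axioms \<sigma>] of_int_sum
    using top by (intro sum.cong) auto
  \<comment> \<open>\<open>zero_in_F\<close> says that the characteristic divides the integer; in
    characteristic 0, divisibility by 0 means being 0.\<close>
  moreover have "of_int (int (EE (aux_digraph D \<sigma> \<psi>)) - int (EO (aux_digraph D \<sigma> \<psi>))) \<noteq> (0 :: 'f)"
    using assms(7) unfolding zero_in_F_def of_int_eq_0_iff_char_dvd cong_0_iff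
    by (metis dvd_0_left_iff of_nat_0)
  ultimately have "(\<Sum>g | g \<in> choices D \<psi> \<and> (\<forall>v\<in>?V. choice_exp D \<psi> g v = out_degree D v). c g) \<noteq> 0"
    by simp
  then obtain f where f: "f \<in> PiE ?V A"
    and nz: "(\<Sum>g\<in>choices D \<psi>. c g * (\<Prod>v\<in>?V. f v ^ choice_exp D \<psi> g v)) \<noteq> 0"
    using coefficient_nullstellensatz[of ?V "choices D \<psi>" A "out_degree D" "choice_exp D \<psi>" c]
      A sum_choice_exp_le by (auto simp: finite_choices)
  have factor: "f (tail D e) - \<phi> e * f (head D e) - a e \<noteq> 0" if "e \<in> ?E" for e
    using nz that unfolding expand [symmetric] by (simp add: prod_zero_iff)
  have "LC_coloring G L C f"
    unfolding LC_coloring_def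
  proof (intro conjI ballI allI impI notI)
    fix v assume "v \<in> mverts G"
    then show "f v \<in> L v" using f A V by (auto simp: PiE_iff)
  next
    fix e u v assume e: "e \<in> medges G" and uv: "mends G e = {u, v}" and "{(u, f u), (v, f v)} \<in> C e"
    \<comment> \<open>The endpoints may be listed against the orientation, but members of
      \<open>C e\<close> are unordered pairs.\<close>
    moreover have "{(u, f u), (v, f v)} = {(tail D e, f (tail D e)), (head D e, f (head D e))}"
      using uv ends[of e] e E by (auto simp: doubleton_eq_iff)
    ultimately have "f (tail D e) - \<phi> e * f (head D e) = a e"
      using a E by simp
    with factor[of e] e E show False by simp
  qed
  then show ?thesis unfolding LC_colorable_def by blast
qed

end
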